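(* Let $\alpha\in(0,1)$ be irrational and let $0<\beta<1$ be such that there are no integers $q\ge1$ and $p$ with $\beta=q\alpha-p$. Then $$\mathcal M_+(\alpha,\beta)=\min\Big\{\liminf_{n\to\infty}\lambda_n(\beta),\ \liminf_{n\to\infty}\rho_n(\beta)\Big\}.$$
   Context: $\|x\|$ is the distance from $x$ to the nearest integer and $\mathcal M_+(\alpha,\beta)=\liminf_{q\to\infty}q\|q\alpha-\beta\|$ over positive integers $q$. Negative continued fraction of $\alpha$: $\alpha_1=\alpha$, $a_i=\lceil1/\alpha_i\rceil$, $\alpha_{i+1}=a_i-1/\alpha_i$. $q_{-1}=0$, $q_0=1$, $q_i=a_iq_{i-1}-q_{i-2}$. $D_0=1$, $D_i=\alpha_1\cdots\alpha_i$. Davenport expansion of $\beta\in[0,1)$: $\beta_1=\beta$, $b_i=\lfloor\beta_i/\alpha_i\rfloor$, $\beta_{i+1}=\beta_i/\alpha_i-b_i$. $Q_n=\sum_{k=1}^n b_kq_{k-1}$; $Q'_n=Q_n+q_{n-1}$ if $Q_n<q_n-q_{n-1}$ and $Q'_n=Q_n+q_{n-1}-q_n$ otherwise. $\lambda_n(\beta)=Q_nD_n\beta_{n+1}$; $\rho_n(\beta)=Q'_nD_n(1-\beta_{n+1})$ if $Q_n<q_n-q_{n-1}$, and $\rho_n(\beta)=Q'_nD_n(1-\alpha_{n+1}-\beta_{n+1})$ if $Q_n\ge q_n-q_{n-1}$. *)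

theory Defs
  imports Complex_Main "HOL-Library.Extended_Real"
begin

definition nearest_int_dist :: "real \<Rightarrow> real" where
  "nearest_int_dist x = \<bar>x - of_int (round x)\<bar>"

text \<open>The lower limit is taken in \<^typ>\<open>ereal\<close>, where it always exists; the term
  for \<open>q = 0\<close> does not affect it.\<close>

definition M_plus :: "real \<Rightarrow> real \<Rightarrow> ereal" where
  "M_plus \<alpha> \<beta> = liminf (\<lambda>q::nat. ereal (real q * nearest_int_dist (real q * \<alpha> - \<beta>)))"

text \<open>The sequences \<open>\<alpha>\<^sub>i\<close>, \<open>a\<^sub>i\<close>, \<open>\<beta>\<^sub>i\<close> and \<open>b\<^sub>i\<close> start at \<open>i = 1\<close>; their values at \<open>0\<close> are
  dummies and never used.\<close>

fun ncf_alpha :: "real \<Rightarrow> nat \<Rightarrow> real" where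
  "ncf_alpha \<alpha> 0 = 0"
| "ncf_alpha \<alpha> (Suc 0) = \<alpha>"
| "ncf_alpha \<alpha> (Suc (Suc i)) =
     of_int \<lceil>1 / ncf_alpha \<alpha> (Suc i)\<rceil> - 1 / ncf_alpha \<alpha> (Suc i)"

definition ncf_a :: "real \<Rightarrow> nat \<Rightarrow> int" where
  "ncf_a \<alpha> i = \<lceil>1 / ncf_alpha \<alpha> i\<rceil>"

text \<open>\<open>ncf_q_shift \<alpha> j\<close> is \<open>q\<^sub>i\<close> for \<open>i = j - 1\<close>, so that the recursion can start at \<open>i = -1\<close>;
  \<open>ncf_q\<close> has the original indices \<open>i \<ge> -1\<close>.\<close>

fun ncf_q_shift :: "real \<Rightarrow> nat \<Rightarrow> int" where
  "ncf_q_shift \<alpha> 0 = 0"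
| "ncf_q_shift \<alpha> (Suc 0) = 1"
| "ncf_q_shift \<alpha> (Suc (Suc j)) =
     ncf_a \<alpha> (Suc j) * ncf_q_shift \<alpha> (Suc j) - ncf_q_shift \<alpha> j"

definition ncf_q :: "real \<Rightarrow> int \<Rightarrow> int" where
  "ncf_q \<alpha> i = ncf_q_shift \<alpha> (nat (i + 1))"

definition ncf_D :: "real \<Rightarrow> nat \<Rightarrow> real" where
  "ncf_D \<alpha> n = (\<Prod>i=1..n. ncf_alpha \<alpha> i)"

fun dav_beta :: "real \<Rightarrow> real \<Rightarrow> nat \<Rightarrow> real" where
  "dav_beta \<alpha> \<beta> 0 = 0"
| "dav_beta \<alpha> \<beta> (Suc 0) = \<beta>"
| "dav_beta \<alpha> \<beta> (Suc (Suc i)) =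
     dav_beta \<alpha> \<beta> (Suc i) / ncf_alpha \<alpha> (Suc i)
       - of_int \<lfloor>dav_beta \<alpha> \<beta> (Suc i) / ncf_alpha \<alpha> (Suc i)\<rfloor>"

definition dav_b :: "real \<Rightarrow> real \<Rightarrow> nat \<Rightarrow> int" where
  "dav_b \<alpha> \<beta> i = \<lfloor>dav_beta \<alpha> \<beta> i / ncf_alpha \<alpha> i\<rfloor>"

definition dav_Q :: "real \<Rightarrow> real \<Rightarrow> nat \<Rightarrow> int" where
  "dav_Q \<alpha> \<beta> n = (\<Sum>k=1..n. dav_b \<alpha> \<beta> k * ncf_q \<alpha> (int k - 1))"

definition dav_Q' :: "real \<Rightarrow> real \<Rightarrow> nat \<Rightarrow> int" where
  "dav_Q' \<alpha> \<beta> n =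
     (if dav_Q \<alpha> \<beta> n < ncf_q \<alpha> (int n) - ncf_q \<alpha> (int n - 1)
      then dav_Q \<alpha> \<beta> n + ncf_q \<alpha> (int n - 1)
      else dav_Q \<alpha> \<beta> n + ncf_q \<alpha> (int n - 1) - ncf_q \<alpha> (int n))"

definition dav_lambda :: "real \<Rightarrow> real \<Rightarrow> nat \<Rightarrow> real" where
  "dav_lambda \<alpha> \<beta> n = of_int (dav_Q \<alpha> \<beta> n) * ncf_D \<alpha> n * dav_beta \<alpha> \<beta> (n + 1)"

definition dav_rho :: "real \<Rightarrow> real \<Rightarrow> nat \<Rightarrow> real" where
  "dav_rho \<alpha> \<beta> n =
     (if dav_Q \<alpha> \<beta> n < ncf_q \<alpha> (int n) - ncf_q \<alpha> (int n - 1)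
      then of_int (dav_Q' \<alpha> \<beta> n) * ncf_D \<alpha> n * (1 - dav_beta \<alpha> \<beta> (n + 1))
      else of_int (dav_Q' \<alpha> \<beta> n) * ncf_D \<alpha> n
             * (1 - ncf_alpha \<alpha> (n + 1) - dav_beta \<alpha> \<beta> (n + 1)))"

end

theory Submission imports Defs begin

text \<open>
  The vectors \<open>e\<^sub>n = (q\<^sub>n\<^sub>-\<^sub>1, D\<^sub>n)\<close> satisfy \<open>e\<^sub>n\<^sub>+\<^sub>2 = a\<^sub>n\<^sub>+\<^sub>1 e\<^sub>n\<^sub>+\<^sub>1 - e\<^sub>n\<close>, and any two consecutive ones form
  a basis of the lattice of all pairs \<open>(q, q\<alpha> - p)\<close>. The values \<open>q (q\<alpha> - p - \<beta>)\<close> are the products of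
  coordinates of points of a translate of this lattice. It contains \<open>P\<^sub>n = (Q\<^sub>n, - D\<^sub>n \<beta>\<^sub>n\<^sub>+\<^sub>1)\<close> below
  the axis and \<open>P'\<^sub>n\<close>, which is \<open>P\<^sub>n + e\<^sub>n\<close> or \<open>P\<^sub>n + e\<^sub>n - e\<^sub>n\<^sub>+\<^sub>1\<close>, above it; their
  products are \<open>\<lambda>\<^sub>n\<close> and \<open>\<rho>\<^sub>n\<close> up to sign. Both first coordinates tend to infinity, which gives one inequality.
  Conversely, a point below the axis with \<open>Q\<^sub>n \<le> q < Q\<^sub>n\<^sub>+\<^sub>1\<close> is no closer to the axis than the last
  point \<open>P\<^sub>n + j e\<^sub>n\<^sub>+\<^sub>1\<close> to the left of it, and on the segment from \<open>P\<^sub>n\<close> to \<open>P\<^sub>n\<^sub>+\<^sub>1\<close>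
  the product is concave, so its minimum is attained at an end; a point above the axis with
  \<open>Q'\<^sub>n \<le> q < Q'\<^sub>n\<^sub>+\<^sub>1\<close> is no closer to the axis than \<open>P'\<^sub>n\<close>.
\<close>

section \<open>Auxiliary facts on integer sequences, products and nearest integers\<close>

text \<open>Without a crossing, \<open>s\<close> would stay at or below \<open>q\<close> by
  induction, against its divergence. The form suits \<open>Q'\<close>, which may fail to increase at
  some steps.\<close>

lemma crossing_index:
  fixes s :: "nat \<Rightarrow> int"
  assumes "s N \<le> q" and "filterlim s at_top sequentially"
  shows "\<exists>n\<ge>N. s n \<le> q \<and> q < s (Suc n)"
proof (rule ccontr)
  assume *: "\<not> ?thesis"
  have below: "s n \<le> q" if "n \<ge> N" for n
    using that by (induction n rule: dec_induct) (use assms(1) * in force)+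
  have "eventually (\<lambda>n. q + 1 \<le> s n) sequentially"
    using assms(2) by (simp add: filterlim_at_top)
  then obtain M where "\<And>n. n \<ge> M \<Longrightarrow> q + 1 \<le> s n"
    by (auto simp: eventually_sequentially)
  from this[of "max M N"] below[of "max M N"] show False by simp
qed

text \<open>As a function of \<open>j\<close> the product is quadratic with leading coefficient
  \<open>- (u * v)\<close>, hence concave.\<close>

lemma concave_product_ge_min:
  fixes j b x y u v :: real
  assumes "0 \<le> j" and "j \<le> b" and "0 \<le> u" and "0 \<le> v"
  shows "min (x * y) ((x + b * u) * (y - b * v)) \<le> (x + j * u) * (y - j * v)"
proof (cases "b = 0")
  case True
  then show ?thesis using assms by simp
next
  case False
  define m where "m = min (x * y) ((x + b * u) * (y - b * v))"
  have b: "b > 0" using False assms by linarith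
  \<comment> \<open>Scaled by \<open>b\<close>: a convex combination of the two end values plus a
    nonnegative defect.\<close>
  have "b * ((x + j * u) * (y - j * v)) =
      (b - j) * (x * y) + j * ((x + b * u) * (y - b * v)) + b * (j * (b - j) * (u * v))"
    by algebra
  moreover have "0 \<le> b * (j * (b - j) * (u * v))"
    using b assms by simp
  moreover have "(b - j) * m \<le> (b - j) * (x * y)"
    by (rule mult_left_mono) (use assms in \<open>auto simp: m_def\<close>)
  moreover have "j * m \<le> j * ((x + b * u) * (y - b * v))"
    by (rule mult_left_mono) (use assms in \<open>auto simp: m_def\<close>)
  moreover have "(b - j) * m + j * m = b * m"
    by (simp add: algebra_simps)
  ultimately have "b * m \<le> b * ((x + j * u) * (y - j * v))" by linarith
  then show ?thesis using b by (simp add: m_def)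
qed

lemma nearest_int_dist_le:
  "nearest_int_dist x \<le> \<bar>x - of_int p\<bar>"
  unfolding nearest_int_dist_def using round_diff_minimal[of x p] by simp

section \<open>The negative continued fraction and its lattice\<close>

locale negative_cf =
  fixes \<alpha> :: real
  assumes alpha_pos: "0 < \<alpha>" and alpha_less_1: "\<alpha> < 1" and alpha_irrational: "\<alpha> \<notin> \<rat>"
begin

text \<open>Indices are shifted: \<open>q n\<close> is \<open>q\<^sub>n\<^sub>-\<^sub>1\<close>, \<open>a n\<close> is \<open>a\<^sub>n\<^sub>+\<^sub>1\<close> and \<open>A n\<close> is \<open>\<alpha>\<^sub>n\<^sub>+\<^sub>1\<close>.\<close>

abbreviation q :: "nat \<Rightarrow> int" where "q n \<equiv> ncf_q_shift \<alpha> n"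
abbreviation a :: "nat \<Rightarrow> int" where "a n \<equiv> ncf_a \<alpha> (Suc n)"
abbreviation A :: "nat \<Rightarrow> real" where "A n \<equiv> ncf_alpha \<alpha> (Suc n)"
abbreviation D :: "nat \<Rightarrow> real" where "D n \<equiv> ncf_D \<alpha> n"

lemma ncf_q_int: "ncf_q \<alpha> (int n) = q (Suc n)" "ncf_q \<alpha> (int n - 1) = q n"
  by (simp_all add: ncf_q_def nat_add_distrib)

lemma inverse_A: "1 / A n = of_int (a n) - A (Suc n)"
  by (simp add: ncf_a_def)

text \<open>Rounding up only gives \<open>0 \<le> A (Suc n)\<close>; irrationality is carried
  through the induction to exclude equality.\<close>

lemma A_bounds: "A n \<notin> \<rat> \<and> 0 < A n \<and> A n < 1"
proof (induction n)
  case 0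
  then show ?case using alpha_pos alpha_less_1 alpha_irrational by simp
next
  case (Suc n)
  have irr: "1 / A n \<notin> \<rat>"
  proof
    assume "1 / A n \<in> \<rat>"
    then have "inverse (1 / A n) \<in> \<rat>" by (rule Rats_inverse)
    then show False using Suc by (simp del: ncf_alpha.simps)
  qed
  have "A (Suc n) \<notin> \<rat>"
  proof
    assume "A (Suc n) \<in> \<rat>"
    then have "of_int (a n) - A (Suc n) \<in> \<rat>" by (intro Rats_diff) auto
    then show False using irr unfolding inverse_A by contradiction
  qed
  moreover have "A (Suc n) \<noteq> 0"
    using \<open>A (Suc n) \<notin> \<rat>\<close> Rats_0 by fastforce
  moreover have "0 \<le> A (Suc n) \<and> A (Suc n) < 1"
    unfolding ncf_alpha.simps(3) by linarith
  ultimately show ?case by linarith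
qed

lemma A_pos: "0 < A n" and A_less_1: "A n < 1"
  using A_bounds by auto

lemma a_ge_2: "a n \<ge> 2"
proof -
  have "1 / A n > 1" using A_pos A_less_1 by simp
  then have "of_int (a n) > (1 :: real)" using inverse_A[of n] A_pos[of "Suc n"] by linarith
  then show ?thesis by linarith
qed

lemma D_0: "D 0 = 1"
  by (simp add: ncf_D_def)

lemma D_Suc: "D (Suc n) = D n * A n"
  by (simp add: ncf_D_def)

lemma D_pos: "D n > 0"
  by (induction n) (simp_all add: D_0 D_Suc A_pos del: ncf_alpha.simps)

lemma D_decreasing: "D (Suc n) < D n"
  using D_pos[of n] A_less_1[of n] by (simp add: D_Suc del: ncf_alpha.simps)

lemma D_rec: "D (Suc (Suc n)) = of_int (a n) * D (Suc n) - D n"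
proof -
  have "A (Suc n) = of_int (a n) - 1 / A n" using inverse_A[of n] by linarith
  then have "D (Suc (Suc n)) = D n * A n * (of_int (a n) - 1 / A n)" by (simp only: D_Suc)
  also have "\<dots> = of_int (a n) * (D n * A n) - D n"
    using A_pos[of n] by (simp add: right_diff_distrib del: ncf_alpha.simps)
  finally show ?thesis by (simp only: D_Suc)
qed

lemma q_rec: "q (Suc (Suc n)) = a n * q (Suc n) - q n"
  by simp

declare ncf_alpha.simps(3) [simp del] ncf_q_shift.simps(3) [simp del]

lemma q_nonneg_increasing: "0 \<le> q n \<and> q n < q (Suc n)"
proof (induction n)
  case (Suc n)
  have "2 * q (Suc n) \<le> a n * q (Suc n)"
    using Suc a_ge_2 by (intro mult_right_mono) auto
  then show ?case using Suc unfolding q_rec by linarith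
qed simp

lemma q_nonneg: "0 \<le> q n" and q_increasing: "q n < q (Suc n)"
  using q_nonneg_increasing by auto

lemma D_repr: "\<exists>p :: int. D n = of_int (q n) * \<alpha> - of_int p"
proof (induction n rule: induct_nat_012)
  case 0
  show ?case by (rule exI[of _ "-1"]) (simp add: D_0)
next
  case 1
  show ?case by (rule exI[of _ 0]) (simp add: D_Suc D_0)
next
  case (ge2 n)
  then obtain p p' where p: "D n = of_int (q n) * \<alpha> - of_int p"
    and p': "D (Suc n) = of_int (q (Suc n)) * \<alpha> - of_int p'" by blast
  have "D (Suc (Suc n)) = of_int (q (Suc (Suc n))) * \<alpha> - of_int (a n * p' - p)"
    unfolding D_rec q_rec p p' by (simp add: algebra_simps)
  then show ?case by blast
qed

lemma lattice_basis:
  fixes u p :: int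
  shows "\<exists>x z :: int. u = x * q n + z * q (Suc n) \<and>
           of_int u * \<alpha> - of_int p = of_int x * D n + of_int z * D (Suc n)"
proof (induction n)
  case 0
  show ?case by (rule exI[of _ "- p"], rule exI[of _ u]) (simp add: D_0 D_Suc)
next
  case (Suc n)
  then obtain x z where "u = x * q n + z * q (Suc n)"
    "of_int u * \<alpha> - of_int p = of_int x * D n + of_int z * D (Suc n)" by blast
  \<comment> \<open>Substituting \<open>q n = a n * q (Suc n) - q (Suc (Suc n))\<close>, and
    likewise for \<open>D\<close>, gives the new coefficients.\<close>
  then show ?case
    by (intro exI[of _ "x * a n + z"] exI[of _ "- x"]) (simp add: q_rec D_rec algebra_simps)
qed

text \<open>A positive limit would force all late digits to be 2; then \<open>D\<close> would be an
  arithmetic progression with negative step and would become negative.\<close>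

lemma D_tendsto_0: "D \<longlonglongrightarrow> 0"
proof -
  have "decseq D" using D_decreasing by (intro decseq_SucI less_imp_le)
  then obtain L where L: "D \<longlonglongrightarrow> L" "\<And>n. L \<le> D n"
    using decseq_convergent[of D 0] D_pos by (metis less_imp_le)
  have "L \<ge> 0" using L(1) D_pos by (intro LIMSEQ_le_const) (auto intro: less_imp_le)
  moreover have False if "L > 0"
  proof -
    \<comment> \<open>With \<open>a n \<ge> 3\<close> the recurrence gives
      \<open>D n + D (Suc (Suc n)) \<ge> 3 * L\<close>, so one of the two terms is at least
      \<open>3 / 2 * L\<close>.\<close>
    have "eventually (\<lambda>n. D n < 3 / 2 * L) sequentially"
      using L(1) that by (intro order_tendstoD(2)) auto
    then obtain N where N: "\<And>n. n \<ge> N \<Longrightarrow> D n < 3 / 2 * L"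
      by (auto simp: eventually_sequentially)
    have a2: "a n = 2" if "n \<ge> N" for n
    proof (rule ccontr)
      assume "a n \<noteq> 2"
      then have "(3 :: real) \<le> of_int (a n)" using a_ge_2[of n] by linarith
      then have "3 * D (Suc n) \<le> of_int (a n) * D (Suc n)"
        using D_pos by (intro mult_right_mono) (auto intro: less_imp_le)
      then show False
        using D_rec[of n] N[of n] N[of "Suc (Suc n)"] L(2)[of "Suc n"] that by linarith
    qed
    define d where "d = D N - D (Suc N)"
    have d: "d > 0" using D_decreasing by (simp add: d_def)
    have "D (N + k) = D N - real k * d \<and> D (N + Suc k) = D N - real (Suc k) * d" for k
    proof (induction k)
      case (Suc k)
      then show ?case using D_rec[of "N + k"] a2[of "N + k"] by (simp add: algebra_simps)
    qed (simp add: d_def)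
    moreover obtain k where "real k * d > D N" using reals_Archimedean3 d by blast
    ultimately have "D (N + k) < 0" by simp
    then show False using D_pos[of "N + k"] by simp
  qed
  ultimately show ?thesis using L(1) by force
qed

text \<open>A best approximation property, read off from the coordinates \<open>x\<close>,
  \<open>z\<close> in the basis. If \<open>z \<ge> 1\<close>, then \<open>u < q (Suc n)\<close>
  forces \<open>z \<le> - x\<close> and a height at most 0. If \<open>z \<le> 0\<close>, then
  \<open>u > 0\<close> forces \<open>x \<ge> 1 - z\<close>, and the height is at least
  \<open>D n\<close>.\<close>

lemma lattice_height_ge_D:
  assumes "0 < u" and "u < q (Suc n)"
    and "v = of_int u * \<alpha> - of_int p" and "0 < v"
  shows "D n \<le> v"
proof -
  obtain x z :: int where u: "u = x * q n + z * q (Suc n)"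
    and v: "v = of_int x * D n + of_int z * D (Suc n)"
    using lattice_basis[of u n p] assms(3) by auto
  show ?thesis
  proof (cases "z \<ge> 1")
    case True
    have "x < 0"
    proof (rule ccontr)
      assume "\<not> x < 0"
      then have "0 \<le> x * q n" using q_nonneg by simp
      moreover have "q (Suc n) \<le> z * q (Suc n)"
        using True q_nonneg[of "Suc n"] by (simp add: mult_le_cancel_right1)
      ultimately show False using u assms(2) by linarith
    qed
    have "z \<le> - x"
    proof (rule ccontr)
      assume "\<not> z \<le> - x"
      then have "(1 - x) * q (Suc n) \<le> z * q (Suc n)"
        using q_nonneg[of "Suc n"] by (intro mult_right_mono) auto
      moreover have "(- x) * q n \<le> (- x) * q (Suc n)"
        using \<open>x < 0\<close> q_increasing[of n] by (intro mult_left_mono) auto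
      ultimately show False using u assms(2) by (simp add: algebra_simps)
    qed
    then have "of_int z * D (Suc n) \<le> of_int (- x) * D (Suc n)"
      using D_pos[of "Suc n"] by (intro mult_right_mono) (simp_all only: of_int_le_iff)
    also have "\<dots> \<le> of_int (- x) * D n"
      using \<open>x < 0\<close> D_decreasing[of n] by (intro mult_left_mono) auto
    finally show ?thesis using v assms(4) by simp
  next
    case False
    have "- z < x"
    proof (rule ccontr)
      assume "\<not> - z < x"
      then have "x * q n \<le> (- z) * q n"
        using q_nonneg by (intro mult_right_mono) auto
      also have "\<dots> \<le> (- z) * q (Suc n)"
        using False q_increasing[of n] by (intro mult_left_mono) auto
      finally show False using u assms(1) by simp
    qed
    then have "of_int (1 - z) * D n \<le> of_int x * D n"
      using D_pos[of n] by (intro mult_right_mono) (simp_all only: of_int_le_iff)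
    moreover have "of_int (- z) * D (Suc n) \<le> of_int (- z) * D n"
      using False D_decreasing[of n] by (intro mult_left_mono) auto
    ultimately show ?thesis using v by (simp add: algebra_simps)
  qed
qed

end

section \<open>The Davenport expansion and its lattice points\<close>

locale davenport = negative_cf +
  fixes \<beta> :: real
  assumes beta_pos: "0 < \<beta>" and beta_less_1: "\<beta> < 1"
    and not_in_orbit: "\<not> (\<exists>q p :: int. q \<ge> 1 \<and> \<beta> = of_int q * \<alpha> - of_int p)"
begin

text \<open>Again \<open>b n\<close> is \<open>b\<^sub>n\<^sub>+\<^sub>1\<close> and \<open>B n\<close> is \<open>\<beta>\<^sub>n\<^sub>+\<^sub>1\<close>. The points \<open>P\<^sub>n\<close> and \<open>P'\<^sub>n\<close> of the
  introduction are \<open>(Q n, - L n)\<close> and \<open>(Q' n, R n)\<close>.\<close>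

abbreviation b :: "nat \<Rightarrow> int" where "b n \<equiv> dav_b \<alpha> \<beta> (Suc n)"
abbreviation B :: "nat \<Rightarrow> real" where "B n \<equiv> dav_beta \<alpha> \<beta> (Suc n)"
abbreviation Q :: "nat \<Rightarrow> int" where "Q n \<equiv> dav_Q \<alpha> \<beta> n"
abbreviation Q' :: "nat \<Rightarrow> int" where "Q' n \<equiv> dav_Q' \<alpha> \<beta> n"

definition L :: "nat \<Rightarrow> real" where "L n = D n * B n"

definition R :: "nat \<Rightarrow> real" where
  "R n = (if Q n < q (Suc n) - q n then D n - L n else D n - D (Suc n) - L n)"

lemma lambda_eq: "dav_lambda \<alpha> \<beta> n = of_int (Q n) * L n"
  by (simp add: dav_lambda_def L_def)

lemma Q'_eq: "Q' n = (if Q n < q (Suc n) - q n then Q n + q n else Q n + q n - q (Suc n))"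
  by (simp add: dav_Q'_def ncf_q_int)

lemma rho_eq: "dav_rho \<alpha> \<beta> n = of_int (Q' n) * R n"
  by (simp add: dav_rho_def ncf_q_int R_def L_def D_Suc algebra_simps)

lemma Q_0: "Q 0 = 0"
  by (simp add: dav_Q_def)

lemma Q_Suc: "Q (Suc n) = Q n + b n * q (Suc n)"
  by (simp add: dav_Q_def ncf_q_int)

lemma B_Suc: "B (Suc n) = B n / A n - of_int (b n)"
  by (simp add: dav_b_def)

declare dav_beta.simps(3) [simp del]

lemma L_Suc: "L (Suc n) = L n - of_int (b n) * D (Suc n)"
  using A_pos[of n] by (simp add: L_def B_Suc D_Suc field_simps)

lemma B_bounds: "0 \<le> B n \<and> B n < 1"
proof (cases n)
  case (Suc m)
  have "B (Suc m) = frac (B m / A m)" by (simp add: B_Suc dav_b_def frac_def)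
  then show ?thesis using Suc frac_ge_0 frac_lt_1 by metis
qed (use beta_pos beta_less_1 in simp)

lemma b_nonneg: "0 \<le> b n"
  using B_bounds[of n] A_pos[of n] by (simp add: dav_b_def)

lemma L_nonneg: "0 \<le> L n" and L_less_D: "L n < D n"
  using B_bounds[of n] D_pos[of n] by (simp_all add: L_def)

text \<open>The cases \<open>c = 0\<close> and \<open>c = 1\<close> bound both the digit
  \<open>b n\<close> and the next remainder \<open>B (Suc n)\<close>.\<close>

lemma B_div_A_less:
  assumes "B n < 1 - of_int c * A n"
  shows "B n / A n < of_int (a n - c) - A (Suc n)"
proof -
  have "B n / A n < (1 - of_int c * A n) / A n"
    using assms A_pos[of n] by (intro divide_strict_right_mono)
  also have "\<dots> = 1 / A n - of_int c"
    using A_pos[of n] by (simp add: field_simps)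
  finally show ?thesis using inverse_A[of n] by simp
qed

lemma b_le: "b n \<le> a n - 1"
proof -
  have "B n / A n < of_int (a n) - A (Suc n)" using B_div_A_less[of n 0] B_bounds[of n] by simp
  then show ?thesis using A_pos[of "Suc n"] unfolding dav_b_def by linarith
qed

lemma b_le':
  assumes "B n < 1 - A n"
  shows "b n \<le> a n - 2"
proof -
  have "B n / A n < of_int (a n - 1) - A (Suc n)" using B_div_A_less[of n 1] assms by simp
  then show ?thesis using A_pos[of "Suc n"] unfolding dav_b_def by linarith
qed

text \<open>The last conjunct makes the induction work: when \<open>Q n\<close> is in the top range,
  it rules out the digit \<open>a n - 1\<close>, which would push \<open>Q (Suc n)\<close> to
  \<open>q (Suc (Suc n))\<close> or beyond. It also makes \<open>R n\<close> nonnegative in its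
  second case.\<close>

lemma Q_invariant:
  "0 \<le> Q n \<and> Q n < q (Suc n) \<and> (q (Suc n) - q n \<le> Q n \<longrightarrow> B n < 1 - A n)"
proof (induction n)
  case 0
  show ?case by (simp add: Q_0)
next
  case (Suc n)
  let ?s = "q (Suc n)"
  have s: "0 < ?s" using q_nonneg[of n] q_increasing[of n] by linarith
  have "0 \<le> b n * ?s" using b_nonneg s by simp
  then have "0 \<le> Q (Suc n)" using Suc by (simp add: Q_Suc)
  moreover have "Q (Suc n) < q (Suc (Suc n))"
  proof (cases "q (Suc n) - q n \<le> Q n")
    case True
    then have "b n * ?s \<le> (a n - 2) * ?s"
      using Suc b_le' s by (intro mult_right_mono) auto
    then show ?thesis using Suc q_increasing[of n] by (simp add: Q_Suc q_rec algebra_simps)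
  next
    case False
    have "b n * ?s \<le> (a n - 1) * ?s"
      using b_le[of n] s by (intro mult_right_mono) auto
    then show ?thesis using False by (simp add: Q_Suc q_rec algebra_simps)
  qed
  moreover have "B (Suc n) < 1 - A (Suc n)" if *: "q (Suc (Suc n)) - q (Suc n) \<le> Q (Suc n)"
  proof (cases "b n = a n - 1")
    case True
    then show ?thesis using B_div_A_less[of n 0] B_bounds[of n] by (simp add: B_Suc)
  next
    case False
    \<comment> \<open>Since \<open>Q n\<close> and \<open>q n\<close> are both below
      \<open>q (Suc n)\<close>, the top range is out of reach for digits below
      \<open>a n - 2\<close>.\<close>
    have "0 < (b n - a n + 3) * ?s"
      using * Suc q_increasing[of n] by (simp add: Q_Suc q_rec algebra_simps)
    then have "b n - a n + 3 > 0" using s by (simp add: zero_less_mult_iff)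
    then have b: "b n = a n - 2" using False b_le[of n] by linarith
    have "(a n - 2) * q (Suc n) = a n * q (Suc n) - 2 * q (Suc n)"
      by (simp add: left_diff_distrib)
    then have "q (Suc n) - q n \<le> Q n" using * unfolding Q_Suc q_rec b by linarith
    then show ?thesis using b Suc B_div_A_less[of n 1] by (simp add: B_Suc)
  qed
  ultimately show ?case by blast
qed

lemma Q_nonneg: "0 \<le> Q n"
  using Q_invariant by blast

lemma Q'_nonneg: "0 \<le> Q' n"
  using Q_nonneg[of n] q_nonneg[of n] by (simp add: Q'_eq)

lemma R_nonneg: "0 \<le> R n"
proof (cases "Q n < q (Suc n) - q n")
  case True
  then show ?thesis using L_less_D[of n] by (simp add: R_def)
next
  case False
  then have "0 \<le> D n * (1 - A n - B n)" using Q_invariant[of n] D_pos[of n] by simp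
  then show ?thesis using False by (simp add: R_def D_Suc L_def algebra_simps)
qed

lemma R_le_D: "R n \<le> D n"
  using L_nonneg[of n] D_pos[of "Suc n"] by (simp add: R_def)

lemma Q_repr: "\<exists>p :: int. of_int (Q n) * \<alpha> - \<beta> - of_int p = - L n"
proof (induction n)
  case 0
  show ?case by (rule exI[of _ 0]) (simp add: Q_0 L_def D_0)
next
  case (Suc n)
  then obtain p :: int where p: "of_int (Q n) * \<alpha> - \<beta> - of_int p = - L n" by blast
  obtain r :: int where r: "D (Suc n) = of_int (q (Suc n)) * \<alpha> - of_int r"
    using D_repr by blast
  have "of_int (Q (Suc n)) * \<alpha> - \<beta> - of_int (p + b n * r) = - L (Suc n)"
    using p unfolding Q_Suc L_Suc r by (simp add: algebra_simps)
  then show ?case by blast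
qed

lemma Q'_repr: "\<exists>p :: int. of_int (Q' n) * \<alpha> - \<beta> - of_int p = R n"
proof -
  obtain p :: int where p: "of_int (Q n) * \<alpha> - \<beta> - of_int p = - L n" using Q_repr by blast
  obtain r :: int where r: "D n = of_int (q n) * \<alpha> - of_int r" using D_repr by blast
  obtain s :: int where s: "D (Suc n) = of_int (q (Suc n)) * \<alpha> - of_int s" using D_repr by blast
  show ?thesis
  proof (cases "Q n < q (Suc n) - q n")
    case True
    then show ?thesis using p r
      by (intro exI[of _ "p + r"]) (simp add: Q'_eq R_def algebra_simps)
  next
    case False
    then show ?thesis using p r s
      by (intro exI[of _ "p + r - s"]) (simp add: Q'_eq R_def algebra_simps)
  qed
qed

section \<open>Divergence of \<open>Q\<close> and \<open>Q'\<close>\<close>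

lemma grid_height_nonzero:
  assumes "0 \<le> u"
  shows "of_int u * \<alpha> - \<beta> - of_int p \<noteq> 0"
proof
  assume *: "of_int u * \<alpha> - \<beta> - of_int p = 0"
  show False
  proof (cases "u = 0")
    case True
    then have "\<beta> = of_int (- p)" using * by simp
    then have "0 < - p" "- p < 1" using beta_pos beta_less_1
      by (metis of_int_0_less_iff, metis of_int_less_1_iff)
    then show False by simp
  next
    case False
    then show False using not_in_orbit assms * by (smt (verit))
  qed
qed

text \<open>Each fixed \<open>u \<ge> 0\<close> has a positive distance to the nearest integer, and
  \<open>D n\<close> eventually falls below it. So \<open>s\<close> finally avoids every finite set
  of nonnegative values.\<close>

lemma filterlim_if_heights_vanish:
  fixes s :: "nat \<Rightarrow> int"
  assumes nonneg: "\<And>n. 0 \<le> s n"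
    and heights: "\<And>n. \<exists>p :: int. \<bar>of_int (s n) * \<alpha> - \<beta> - of_int p\<bar> \<le> D n"
  shows "filterlim s at_top sequentially"
proof -
  have ne: "eventually (\<lambda>n. s n \<noteq> u) sequentially" if u: "0 \<le> u" for u
  proof -
    define h where "h = nearest_int_dist (of_int u * \<alpha> - \<beta>)"
    have "h > 0" using grid_height_nonzero[OF u] by (simp add: h_def nearest_int_dist_def)
    then have "eventually (\<lambda>n. D n < h) sequentially"
      using D_tendsto_0 by (intro order_tendstoD(2)) auto
    then show ?thesis
    proof eventually_elim
      case (elim n)
      show ?case using heights[of n] nearest_int_dist_le elim unfolding h_def
        by (metis le_less_trans not_less)
    qed
  qed
  have "eventually (\<lambda>n. Z \<le> s n) sequentially" for Z
  proof -
    have "eventually (\<lambda>n. \<forall>u\<in>{0..<Z}. s n \<noteq> u) sequentially"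
      using ne by (simp add: eventually_ball_finite)
    then show ?thesis
      by eventually_elim (use nonneg in \<open>auto simp: not_less[symmetric]\<close>)
  qed
  then show ?thesis by (simp add: filterlim_at_top)
qed

lemma Q_filterlim: "filterlim Q at_top sequentially"
proof (rule filterlim_if_heights_vanish)
  fix n
  show "\<exists>p :: int. \<bar>of_int (Q n) * \<alpha> - \<beta> - of_int p\<bar> \<le> D n"
    using Q_repr[of n] L_nonneg[of n] L_less_D[of n] by (metis abs_minus abs_of_nonneg less_imp_le)
qed (rule Q_nonneg)

lemma Q'_filterlim: "filterlim Q' at_top sequentially"
proof (rule filterlim_if_heights_vanish)
  fix n
  show "\<exists>p :: int. \<bar>of_int (Q' n) * \<alpha> - \<beta> - of_int p\<bar> \<le> D n"
    using Q'_repr[of n] R_nonneg[of n] R_le_D[of n] by (metis abs_of_nonneg)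
qed (rule Q'_nonneg)

section \<open>Points between consecutive \<open>Q\<close> or \<open>Q'\<close>\<close>

lemma below_ge_min_lambda:
  assumes q: "Q n \<le> u" "u < Q (Suc n)"
    and y: "y = of_int u * \<alpha> - \<beta> - of_int p" "y < 0"
  shows "min (dav_lambda \<alpha> \<beta> n) (dav_lambda \<alpha> \<beta> (Suc n)) \<le> of_int u * \<bar>y\<bar>"
proof -
  let ?s = "q (Suc n)"
  \<comment> \<open>Euclidean division finds the last point \<open>(Q n + j * ?s, - \<eta>)\<close>
    with first coordinate at most \<open>u\<close>; \<open>j \<le> b n\<close> puts it on the
    segment.\<close>
  define j where "j = (u - Q n) div ?s"
  define w where "w = (u - Q n) mod ?s"
  define \<eta> where "\<eta> = L n - of_int j * D (Suc n)"
  have s: "0 < ?s" using q_nonneg[of n] q_increasing[of n] by linarith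
  have u: "u = Q n + j * ?s + w" unfolding j_def w_def
    using div_mult_mod_eq[of "u - Q n" ?s] by linarith
  have w: "0 \<le> w" "w < ?s" using s by (simp_all add: w_def)
  have j: "0 \<le> j" using q(1) s by (simp add: j_def pos_imp_zdiv_nonneg_iff)
  have "j * ?s < b n * ?s" using q(2) u w unfolding Q_Suc by linarith
  then have jb: "j \<le> b n" using s mult_less_cancel_right_pos[of ?s j "b n"] by linarith
  have "of_int j * D (Suc n) \<le> of_int (b n) * D (Suc n)"
    using jb D_pos[of "Suc n"] by (intro mult_right_mono) auto
  then have \<eta>: "0 \<le> \<eta>" using L_nonneg[of "Suc n"] by (simp add: \<eta>_def L_Suc)
  have "0 \<le> of_int j * D (Suc n)" using j D_pos[of "Suc n"] by simp
  then have \<eta>_less: "\<eta> < D n" using L_less_D[of n] by (simp add: \<eta>_def)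
  \<comment> \<open>Otherwise the difference to that point has width \<open>w < ?s\<close> and
    height strictly between 0 and \<open>D n\<close>. For \<open>w > 0\<close> this contradicts
    \<open>lattice_height_ge_D\<close>; for \<open>w = 0\<close> the height would be an integer in
    the open unit interval.\<close>
  have "\<eta> \<le> - y"
  proof (rule ccontr)
    assume "\<not> \<eta> \<le> - y"
    then have v: "0 < y + \<eta>" "y + \<eta> < D n" using y(2) \<eta>_less by auto
    obtain r :: int where r: "of_int (Q n) * \<alpha> - \<beta> - of_int r = - L n" using Q_repr by blast
    obtain t :: int where t: "D (Suc n) = of_int ?s * \<alpha> - of_int t" using D_repr by blast
    have repr: "y + \<eta> = of_int w * \<alpha> - of_int (p - r - j * t)"
      using r by (simp add: y(1) \<eta>_def u t algebra_simps)
    show False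
    proof (cases "w = 0")
      case True
      have "D n \<le> 1"
        using decseqD[OF decseq_SucI[of D], of 0 n] D_decreasing D_0 by (auto intro: less_imp_le)
      then have "0 < real_of_int (- (p - r - j * t))" "real_of_int (- (p - r - j * t)) < 1"
        using repr True v by auto
      then show False unfolding of_int_0_less_iff of_int_less_1_iff by linarith
    next
      case False
      then show False using lattice_height_ge_D[OF _ w(2) repr v(1)] w v(2) by simp
    qed
  qed
  have "min (of_int (Q n) * L n)
          ((of_int (Q n) + of_int (b n) * of_int ?s) * (L n - of_int (b n) * D (Suc n)))
        \<le> (of_int (Q n) + of_int j * of_int ?s) * (L n - of_int j * D (Suc n))"
    using j jb s D_pos[of "Suc n"] by (intro concave_product_ge_min) auto
  then have "min (dav_lambda \<alpha> \<beta> n) (dav_lambda \<alpha> \<beta> (Suc n)) \<le> of_int (Q n + j * ?s) * \<eta>"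
    by (simp add: lambda_eq Q_Suc L_Suc \<eta>_def)
  also have "\<dots> \<le> of_int u * \<bar>y\<bar>"
  proof (rule mult_mono)
    show "\<eta> \<le> \<bar>y\<bar>" using \<open>\<eta> \<le> - y\<close> y(2) by simp
    show "real_of_int (Q n + j * ?s) \<le> of_int u" using u w by linarith
    show "0 \<le> real_of_int u" using q(1) Q_nonneg[of n] by linarith
  qed (rule \<eta>)
  finally show ?thesis .
qed

text \<open>The steps ending in the second case of the definition of \<open>Q'\<^sub>n\<^sub>+\<^sub>1\<close> do not increase \<open>Q'\<close>.\<close>

lemma Q'_step:
  assumes "Q' n < Q' (Suc n)"
  shows "\<exists>c. Q' (Suc n) = Q' n + c * q (Suc n) - q n \<and>
             R (Suc n) = R n + of_int c * D (Suc n) - D n"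
proof -
  let ?s = "q (Suc n)"
  have s: "0 \<le> ?s" by (rule q_nonneg)
  show ?thesis
  proof (cases "Q (Suc n) < q (Suc (Suc n)) - q (Suc n)")
    case True
    show ?thesis
    \<comment> \<open>In either case the next point adds \<open>b n + 1\<close> copies of
      \<open>(q (Suc n), D (Suc n))\<close> to \<open>(Q n, - L n)\<close>; one more copy undoes the
      subtraction in the second case of \<open>Q' n\<close>.\<close>
    proof (cases "Q n < q (Suc n) - q n")
      case True': True
      show ?thesis using True True'
        by (intro exI[of _ "b n + 1"]) (simp add: Q'_eq R_def Q_Suc L_Suc algebra_simps)
    next
      case False
      show ?thesis using True False
        by (intro exI[of _ "b n + 2"]) (simp add: Q'_eq R_def Q_Suc L_Suc algebra_simps)
    qed
  next
    case False
    then have Q'_Suc: "Q' (Suc n) = Q n + q n + b n * ?s + ?s - a n * ?s"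
      by (simp add: Q'_eq Q_Suc q_rec algebra_simps)
    have "Q' (Suc n) \<le> Q' n"
    proof (cases "Q n < q (Suc n) - q n")
      case True
      have "b n * ?s \<le> (a n - 1) * ?s" using b_le[of n] s by (rule mult_right_mono)
      then show ?thesis using True Q'_Suc by (simp add: Q'_eq algebra_simps)
    next
      case False
      then have "b n \<le> a n - 2" using b_le' Q_invariant[of n] by simp
      then have "b n * ?s \<le> (a n - 2) * ?s" using s by (rule mult_right_mono)
      then show ?thesis using False Q'_Suc by (simp add: Q'_eq algebra_simps)
    qed
    then show ?thesis using assms by simp
  qed
qed

lemma above_ge_rho:
  assumes q: "Q' n \<le> u" "u < Q' (Suc n)"
    and y: "y = of_int u * \<alpha> - \<beta> - of_int p" "0 < y"
  shows "dav_rho \<alpha> \<beta> n \<le> of_int u * \<bar>y\<bar>"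
proof -
  have "R n \<le> y"
  proof (rule ccontr)
    assume less: "\<not> R n \<le> y"
    obtain c where c: "Q' (Suc n) = Q' n + c * q (Suc n) - q n"
      "R (Suc n) = R n + of_int c * D (Suc n) - D n"
      using Q'_step q by force
    obtain r :: int where r: "of_int (Q' n) * \<alpha> - \<beta> - of_int r = R n" using Q'_repr by blast
    obtain x z :: int where u: "u - Q' n = x * q n + z * q (Suc n)"
      and v: "of_int (u - Q' n) * \<alpha> - of_int (p - r) = of_int x * D n + of_int z * D (Suc n)"
      using lattice_basis[of "u - Q' n" n "p - r"] by blast
    have v': "y - R n = of_int x * D n + of_int z * D (Suc n)"
      using v r y(1) by (simp add: algebra_simps)
    \<comment> \<open>For \<open>x \<ge> 0\<close> the drop in height needs \<open>z < 0\<close>,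
      while nonnegative width forces \<open>- z \<le> x\<close>, so the height could not
      drop.\<close>
    have x: "x \<le> - 1"
    proof (rule ccontr)
      assume x: "\<not> x \<le> - 1"
      have "0 \<le> of_int x * D n" using x D_pos[of n] by simp
      then have "of_int z * D (Suc n) < 0" using less v' by linarith
      then have z: "z < 0" using D_pos[of "Suc n"] by (simp add: mult_less_0_iff)
      have "- z \<le> x"
      proof (rule ccontr)
        assume "\<not> - z \<le> x"
        then have "x * q n \<le> (- z) * q n"
          using q_nonneg by (intro mult_right_mono) auto
        also have "\<dots> < (- z) * q (Suc n)"
          using z q_increasing[of n] by (intro mult_strict_left_mono) auto
        finally show False using u q(1) by simp
      qed
      then have "of_int (- z) * D n \<le> of_int x * D n"
        using D_pos[of n] by (intro mult_right_mono) (simp_all only: of_int_le_iff)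
      moreover have "of_int (- z) * D (Suc n) \<le> of_int (- z) * D n"
        using z D_decreasing[of n] by (intro mult_left_mono) auto
      ultimately show False using v' less by simp
    qed
    \<comment> \<open>These are the coordinates of the difference from \<open>(u, y)\<close> to
      \<open>(Q' (Suc n), R (Suc n))\<close>. Positive width gives \<open>x' + z' \<ge> 1\<close>,
      so \<open>y\<close> lies at least \<open>D (Suc n) \<ge> R (Suc n)\<close> below
      \<open>R (Suc n)\<close>.\<close>
    define x' where "x' = - 1 - x"
    define z' where "z' = c - z"
    have x': "0 \<le> x'" using x by (simp add: x'_def)
    have "0 < x' * q n + z' * q (Suc n)"
      using u q(2) c(1) by (simp add: x'_def z'_def algebra_simps)
    also have "\<dots> \<le> x' * q (Suc n) + z' * q (Suc n)"
      using x' q_increasing[of n] by (intro add_right_mono mult_left_mono) auto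
    finally have "0 < (x' + z') * q (Suc n)" by (simp add: algebra_simps)
    then have "1 \<le> x' + z'" using q_nonneg[of "Suc n"] by (simp add: zero_less_mult_iff)
    then have "1 * D (Suc n) \<le> of_int (x' + z') * D (Suc n)"
      using D_pos[of "Suc n"] by (intro mult_right_mono) auto
    moreover have "of_int x' * D (Suc n) \<le> of_int x' * D n"
      using x' D_decreasing[of n] by (intro mult_left_mono) auto
    moreover have "y = R (Suc n) - of_int x' * D n - of_int z' * D (Suc n)"
      using v' c(2) by (simp add: x'_def z'_def algebra_simps)
    ultimately have "y \<le> 0" using R_le_D[of "Suc n"] by (simp add: algebra_simps)
    then show False using y(2) by simp
  qed
  moreover have "0 \<le> u" using q(1) Q'_nonneg[of n] by linarith
  ultimately show ?thesis
    using q(1) y(2) R_nonneg[of n] by (simp add: rho_eq mult_mono)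
qed

section \<open>Comparison of the lower limits\<close>

text \<open>The values defining \<open>M_plus\<close> are sampled along the divergent
  \<open>s\<close>, and \<open>h n\<close> dominates the distance to the nearest integer
  there.\<close>

lemma M_plus_le_liminf:
  fixes s :: "nat \<Rightarrow> int"
  assumes nonneg: "\<And>n. 0 \<le> s n" and lim: "filterlim s at_top sequentially"
    and heights: "\<And>n. \<exists>p :: int. \<bar>of_int (s n) * \<alpha> - \<beta> - of_int p\<bar> \<le> h n"
  shows "M_plus \<alpha> \<beta> \<le> liminf (\<lambda>n. ereal (of_int (s n) * h n))"
  unfolding le_Liminf_iff
proof (intro allI impI)
  fix c assume "c < M_plus \<alpha> \<beta>"
  then have "eventually (\<lambda>k. c < ereal (real k * nearest_int_dist (real k * \<alpha> - \<beta>))) sequentially"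
    unfolding M_plus_def using less_LiminfD by blast
  moreover have "filterlim (\<lambda>n. nat (s n)) sequentially sequentially"
    using filterlim_compose[OF filterlim_nat_sequentially lim] by simp
  ultimately have "eventually (\<lambda>n. c < ereal (real (nat (s n)) *
      nearest_int_dist (real (nat (s n)) * \<alpha> - \<beta>))) sequentially"
    using eventually_compose_filterlim by blast
  then show "eventually (\<lambda>n. c < ereal (of_int (s n) * h n)) sequentially"
  proof eventually_elim
    case (elim n)
    have "nearest_int_dist (of_int (s n) * \<alpha> - \<beta>) \<le> h n"
      using heights[of n] nearest_int_dist_le order_trans by blast
    then have "of_int (s n) * nearest_int_dist (of_int (s n) * \<alpha> - \<beta>) \<le> of_int (s n) * h n"
      using nonneg[of n] by (intro mult_left_mono) auto
    then show ?case using elim nonneg[of n] by (simp add: less_le_trans)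
  qed
qed

lemma M_plus_le_lambda: "M_plus \<alpha> \<beta> \<le> liminf (\<lambda>n. ereal (dav_lambda \<alpha> \<beta> n))"
  unfolding lambda_eq
proof (rule M_plus_le_liminf[OF Q_nonneg Q_filterlim])
  fix n
  show "\<exists>p :: int. \<bar>of_int (Q n) * \<alpha> - \<beta> - of_int p\<bar> \<le> L n"
    using Q_repr[of n] L_nonneg[of n] by (metis abs_minus abs_of_nonneg order_refl)
qed

lemma M_plus_le_rho: "M_plus \<alpha> \<beta> \<le> liminf (\<lambda>n. ereal (dav_rho \<alpha> \<beta> n))"
  unfolding rho_eq
proof (rule M_plus_le_liminf[OF Q'_nonneg Q'_filterlim])
  fix n
  show "\<exists>p :: int. \<bar>of_int (Q' n) * \<alpha> - \<beta> - of_int p\<bar> \<le> R n"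
    using Q'_repr[of n] R_nonneg[of n] by (metis abs_of_nonneg order_refl)
qed

lemma M_plus_ge:
  "min (liminf (\<lambda>n. ereal (dav_lambda \<alpha> \<beta> n))) (liminf (\<lambda>n. ereal (dav_rho \<alpha> \<beta> n)))
     \<le> M_plus \<alpha> \<beta>"
  unfolding M_plus_def le_Liminf_iff
proof (intro allI impI)
  fix c
  assume "c < min (liminf (\<lambda>n. ereal (dav_lambda \<alpha> \<beta> n))) (liminf (\<lambda>n. ereal (dav_rho \<alpha> \<beta> n)))"
  then have "eventually (\<lambda>n. c < ereal (dav_lambda \<alpha> \<beta> n)) sequentially"
    "eventually (\<lambda>n. c < ereal (dav_rho \<alpha> \<beta> n)) sequentially"
    by (auto dest: less_LiminfD)
  then have "eventually (\<lambda>n. c < ereal (dav_lambda \<alpha> \<beta> n) \<and> c < ereal (dav_rho \<alpha> \<beta> n)) sequentially"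
    by (rule eventually_conj)
  then obtain N where N: "\<And>n. n \<ge> N \<Longrightarrow> c < ereal (dav_lambda \<alpha> \<beta> n)"
    "\<And>n. n \<ge> N \<Longrightarrow> c < ereal (dav_rho \<alpha> \<beta> n)"
    by (auto simp: eventually_sequentially)
  \<comment> \<open>The threshold on \<open>k\<close> lets \<open>crossing_index\<close> start at
    \<open>N\<close> for both \<open>Q\<close> and \<open>Q'\<close>.\<close>
  have "c < ereal (real k * nearest_int_dist (real k * \<alpha> - \<beta>))"
    if k: "k \<ge> nat (max (Q N) (Q' N))" for k
  proof -
    define p where "p = round (real k * \<alpha> - \<beta>)"
    define y where "y = of_int (int k) * \<alpha> - \<beta> - of_int p"
    have dist: "nearest_int_dist (real k * \<alpha> - \<beta>) = \<bar>y\<bar>"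
      by (simp add: nearest_int_dist_def y_def p_def)
    have "y \<noteq> 0" unfolding y_def by (rule grid_height_nonzero) simp
    then consider "y < 0" | "0 < y" by linarith
    then have "c < ereal (of_int (int k) * \<bar>y\<bar>)"
    proof cases
      case 1
      obtain n where n: "n \<ge> N" "Q n \<le> int k" "int k < Q (Suc n)"
        using crossing_index[OF _ Q_filterlim, of N "int k"] k by (auto simp: nat_le_iff)
      have "c < ereal (min (dav_lambda \<alpha> \<beta> n) (dav_lambda \<alpha> \<beta> (Suc n)))"
        using N(1)[of n] N(1)[of "Suc n"] n(1) by (simp add: min_def)
      also have "\<dots> \<le> ereal (of_int (int k) * \<bar>y\<bar>)"
        using below_ge_min_lambda[OF n(2,3) y_def 1] by (simp only: ereal_less_eq)
      finally show ?thesis .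
    next
      case 2
      obtain n where n: "n \<ge> N" "Q' n \<le> int k" "int k < Q' (Suc n)"
        using crossing_index[OF _ Q'_filterlim, of N "int k"] k by (auto simp: nat_le_iff)
      have "ereal (dav_rho \<alpha> \<beta> n) \<le> ereal (of_int (int k) * \<bar>y\<bar>)"
        using above_ge_rho[OF n(2,3) y_def 2] by (simp only: ereal_less_eq)
      then show ?thesis using N(2)[OF n(1)] by (rule less_le_trans[rotated])
    qed
    then show ?thesis by (simp add: dist)
  qed
  then show "eventually (\<lambda>k. c < ereal (real k * nearest_int_dist (real k * \<alpha> - \<beta>))) sequentially"
    using eventually_sequentially by blast
qed

end

theorem theorem4p4:
  fixes \<alpha> \<beta> :: real
  assumes "0 < \<alpha>" and "\<alpha> < 1" and "\<alpha> \<notin> \<rat>"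
    and "0 < \<beta>" and "\<beta> < 1"
    and "\<not> (\<exists>q p :: int. q \<ge> 1 \<and> \<beta> = of_int q * \<alpha> - of_int p)"
  shows "M_plus \<alpha> \<beta> =
    min (liminf (\<lambda>n. ereal (dav_lambda \<alpha> \<beta> n))) (liminf (\<lambda>n. ereal (dav_rho \<alpha> \<beta> n)))"
proof -
  interpret davenport \<alpha> \<beta>
    using assms by unfold_locales
  show ?thesis
    using M_plus_ge M_plus_le_lambda M_plus_le_rho by (intro antisym) auto
qed

end
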